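(* Take any $p\in(0,\infty)$ and $u\in\mathbb{R}$. Take any real-valued random variable $X$ such that $\mathsf{E}|X|^p<\infty$. Let $f$ be the characteristic function of $X$. Let $\ell:=\lceil p-1\rceil$ and $\lambda:=p-\ell$. Then $$\mathsf{E}X_+^p e^{iuX}=\frac{f^{(p)}(u)}{2i^p}\,\mathsf{I}\{p\in\mathbb{N}\}+\frac{\Gamma(\lambda+1)}{2\pi i^\ell}\int_0^\infty\Big(\frac{f^{(\ell)}(u+t)-f^{(\ell)}(u)}{(it)^{\lambda+1}}+\frac{f^{(\ell)}(u-t)-f^{(\ell)}(u)}{(-it)^{\lambda+1}}\Big)\,dt,$$ where the integral exists in the Lebesgue sense (and is finite).
   Context: $\mathbb{N}=\{1,2,\dots\}$; $\mathsf{I}\{\cdot\}$ is the indicator. $x_+^p:=x^p$ if $x>0$ and $x_+^p:=0$ otherwise. For nonzero complex $z$, $\arg z\in(-\pi,\pi]$ and $z^s:=|z|^s e^{is\arg z}$. $f^{(\ell)}$ is the usual derivative of the nonnegative integer order $\ell$ (with $f^{(0)}=f$); the term with $f^{(p)}$ is present only when $p\in\mathbb{N}$, in which case $f^{(p)}$ is the usual derivative. *)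

theory Defs
  imports "HOL-Probability.Probability"
begin

definition pos_part_powr :: "real \<Rightarrow> real \<Rightarrow> real" where
  "pos_part_powr x p = (if x > 0 then x powr p else 0)"

(* deriv needs equal domain and codomain; for curves real => complex we iterate
   vector_derivative.  As vector_derivative is total, times_differentiable
   records that the iterated derivatives up to order n really exist. *)
definition nth_derivative :: "nat \<Rightarrow> (real \<Rightarrow> complex) \<Rightarrow> real \<Rightarrow> complex" where
  "nth_derivative n f = ((\<lambda>g t. vector_derivative g (at t)) ^^ n) f"

definition times_differentiable :: "nat \<Rightarrow> (real \<Rightarrow> complex) \<Rightarrow> bool" where
  "times_differentiable n f \<longleftrightarrow> (\<forall>k<n. \<forall>t. nth_derivative k f differentiable (at t))"

(* powr on complex numbers uses the principal logarithm Ln (Im in (-pi, pi]), so that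
   z powr s = |z|^s * exp(i s arg z) for z \<noteq> 0. *)
definition frac_integrand :: "(real \<Rightarrow> complex) \<Rightarrow> real \<Rightarrow> real \<Rightarrow> real \<Rightarrow> complex" where
  "frac_integrand g s u t =
     (g (u + t) - g u) / (\<i> * of_real t) powr (of_real s) +
     (g (u - t) - g u) / (- \<i> * of_real t) powr (of_real s)"

end

theory Submission
  imports Defs
begin

text \<open>
  For a point mass at \<open>x\<close>, the two difference quotients combine to the real kernel
  \<open>2 (cos (x t - \<pi> s / 2) - cos (\<pi> s / 2)) / t powr s\<close> with \<open>s = \<lambda> + 1\<close>. Its integral over
  \<open>t > 0\<close> is homogeneous of degree \<open>\<lambda>\<close> in \<open>x\<close>: the cosine part yields \<open>\<bar>x\<bar> powr \<lambda>\<close> and the sine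
  part \<open>sgn x * \<bar>x\<bar> powr \<lambda>\<close> with the same constant \<open>\<pi> / \<Gamma>(\<lambda> + 1)\<close>, so that they cancel for
  \<open>x < 0\<close>. For \<open>\<lambda> = 1\<close> the sine part is absent, and the missing half is the term with the
  \<open>p\<close>-th derivative. Homogeneity also bounds the integral of the absolute value by
  \<open>C * \<bar>x\<bar> powr \<lambda>\<close>, so that the moment condition permits Fubini's theorem.
\<close>

section \<open>The cosine integral by Gamma and Beta integrals\<close>

text \<open>Scaling \<open>y\<close> by \<open>t\<close> in the Gamma integral produces the factor
  \<open>t powr b\<close>. Read from right to left, this is a negative power of \<open>t\<close> as
  a Laplace transform; the form as a nonnegative integral suits Tonelli's theorem.\<close>

lemma nn_integral_powr_exp:
  fixes b t :: real
  assumes "b > 0" "t > 0"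
  shows "(\<integral>\<^sup>+y. ennreal (y powr (b - 1) * exp (- t * y)) * indicator {0<..} y \<partial>lborel)
    = ennreal (Gamma b / t powr b)"
proof -
  have "ennreal (Gamma b)
      = (\<integral>\<^sup>+y. ennreal (indicator {0..} y * y powr (b - 1) / exp y) \<partial>lborel)"
    by (rule Gamma_conv_nn_integral_real[OF assms(1)])
  also have "\<dots> = ennreal \<bar>t\<bar> *
      (\<integral>\<^sup>+y. ennreal (indicator {0..} (0 + t * y) * (0 + t * y) powr (b - 1) / exp (0 + t * y)) \<partial>lborel)"
    using assms by (intro nn_integral_real_affine) auto
  also have "\<dots> = (\<integral>\<^sup>+y. ennreal (t powr b) *
      (ennreal (y powr (b - 1) * exp (- t * y)) * indicator {0<..} y) \<partial>lborel)"
    using assms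
    by (subst nn_integral_cmult[symmetric])
      (auto intro!: nn_integral_cong
        simp: indicator_def ennreal_mult'[symmetric] powr_mult powr_diff exp_minus field_simps
          zero_le_mult_iff)
  also have "\<dots> = ennreal (t powr b) *
      (\<integral>\<^sup>+y. ennreal (y powr (b - 1) * exp (- t * y)) * indicator {0<..} y \<partial>lborel)"
    by (rule nn_integral_cmult) auto
  finally have "ennreal (Gamma b) * ennreal (1 / t powr b) = ennreal (t powr b) * ennreal (1 / t powr b) *
      (\<integral>\<^sup>+y. ennreal (y powr (b - 1) * exp (- t * y)) * indicator {0<..} y \<partial>lborel)"
    by (simp add: mult_ac)
  also have "ennreal (t powr b) * ennreal (1 / t powr b) = 1"
    using assms by (simp flip: ennreal_mult' add: ennreal_1[symmetric] del: ennreal_1)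
  finally show ?thesis
    using assms by (simp flip: ennreal_mult'' )
qed

text \<open>Substituting \<open>t = y\<^sup>2 / (1 + y\<^sup>2)\<close> turns the integral into a Beta integral.\<close>
lemma nn_integral_powr_div_1_plus_square:
  fixes a :: real
  assumes "0 < a" "a < 2"
  shows "(\<integral>\<^sup>+y. ennreal (y powr (a - 1) / (1 + y\<^sup>2)) * indicator {0<..} y \<partial>lborel)
    = ennreal (pi / (2 * sin (pi * a / 2)))"
proof -
  define g :: "real \<Rightarrow> real" where "g y = y\<^sup>2 / (1 + y\<^sup>2)" for y
  define g' :: "real \<Rightarrow> real" where "g' y = 2 * y / (1 + y\<^sup>2)\<^sup>2" for y
  \<comment> \<open>The integrand of \<open>Beta (a/2) (1 - a/2)\<close>. The exponents are such
    that \<open>\<bar>g' y\<bar> * \<phi> (g y)\<close> is twice the integrand sought.\<close>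
  define \<phi> :: "real \<Rightarrow> real" where "\<phi> t = t powr (a / 2 - 1) * (1 - t) powr ((1 - a / 2) - 1)" for t
  have pos: "1 + y\<^sup>2 > 0" for y :: real
    by (simp add: add_pos_nonneg)
  have inj: "inj_on g {0<..}"
  proof (rule inj_onI)
    fix x y :: real assume xy: "x \<in> {0<..}" "y \<in> {0<..}" "g x = g y"
    then have "x\<^sup>2 = y\<^sup>2"
      using pos[of x] pos[of y] by (simp add: g_def field_simps)
    then show "x = y" using xy by (simp add: power2_eq_iff)
  qed
  have img: "g ` {0<..} = {0<..<1}"
  proof (intro equalityI subsetI)
    fix t assume "t \<in> g ` {0<..}"
    then show "t \<in> {0<..<1}" using pos by (auto simp: g_def)
  next
    fix t :: real assume t: "t \<in> {0<..<1}"
    then have "1 + t / (1 - t) = 1 / (1 - t)" by (simp add: field_simps)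
    \<comment> \<open>The witness solves \<open>y\<^sup>2 / (1 + y\<^sup>2) = t\<close> for positive
      \<open>y\<close>.\<close>
    with t have "t = g (sqrt (t / (1 - t)))" by (simp add: g_def)
    with t show "t \<in> g ` {0<..}" by (intro image_eqI[of _ _ "sqrt (t / (1 - t))"]) auto
  qed
  have der: "(g has_field_derivative g' x) (at x within {0<..})" for x
    unfolding g_def g'_def using pos[of x]
    by (auto intro!: derivative_eq_intros simp: field_simps power2_eq_square)
  have "(\<phi> has_integral Beta (a/2) (1 - a/2)) {0..1}"
    unfolding \<phi>_def using has_integral_Beta_real[of "a/2" "1 - a/2"] assms by simp
  \<comment> \<open>The endpoints are a null set; without them the domain is exactly the image of
    \<open>g\<close>.\<close>
  then have hi: "(\<phi> has_integral Beta (a/2) (1 - a/2)) {0<..<1}"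
    by (simp add: has_integral_Icc_iff_Ioo)
  moreover have "\<phi> absolutely_integrable_on {0<..<1}"
    by (rule nonnegative_absolutely_integrable_1)
      (use hi in \<open>auto simp: \<phi>_def has_integral_iff\<close>)
  ultimately have "(\<lambda>x. \<bar>g' x\<bar> * \<phi> (g x)) absolutely_integrable_on {0<..} \<and>
      integral {0<..} (\<lambda>x. \<bar>g' x\<bar> * \<phi> (g x)) = Beta (a/2) (1 - a/2)"
    by (subst has_absolute_integral_change_of_variables_1'[OF _ der inj])
      (auto simp: img has_integral_iff)
  then have "((\<lambda>x. \<bar>g' x\<bar> * \<phi> (g x)) has_integral Beta (a/2) (1 - a/2)) {0<..}"
    by (simp add: has_integral_iff set_lebesgue_integral_eq_integral(1))
  then have "((\<lambda>x. 2 * (x powr (a - 1) / (1 + x\<^sup>2))) has_integral Beta (a/2) (1 - a/2)) {0<..}"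
  proof (rule has_integral_eq[rotated])
    fix x :: real assume "x \<in> {0<..}"
    then have x: "x > 0" by simp
    have 1: "1 - g x = 1 / (1 + x\<^sup>2)" using pos[of x] by (simp add: g_def field_simps)
    have 2: "(x\<^sup>2) powr c = x powr (2 * c)" for c
    proof -
      have "(x\<^sup>2) powr c = (x powr 2) powr c"
        using x by (simp only: powr_numeral)
      then show ?thesis by (simp only: powr_powr)
    qed
    have 5: "1 / (1 + x\<^sup>2) powr (a / 2 - 1) = (1 + x\<^sup>2) powr (1 - a / 2)"
      using powr_minus_divide[of "1 + x\<^sup>2" "a / 2 - 1"] by (simp only: minus_diff_eq)
    have 6: "1 / (1 + x\<^sup>2) powr (- (a / 2)) = (1 + x\<^sup>2) powr (a / 2)"
      using powr_minus_divide[of "1 + x\<^sup>2" "- (a / 2)"] by (simp only: minus_minus)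
    have "\<phi> (g x) = (x\<^sup>2) powr (a / 2 - 1) * (1 / (1 + x\<^sup>2) powr (a / 2 - 1) * (1 / (1 + x\<^sup>2) powr (- (a / 2))))"
      unfolding \<phi>_def 1 using x pos[of x] by (simp add: g_def powr_divide)
    also have "\<dots> = x powr (2 * (a / 2 - 1)) * (1 + x\<^sup>2) powr ((1 - a / 2) + a / 2)"
      unfolding 2 5 6 powr_add ..
    also have "\<dots> = x powr (a - 2) * (1 + x\<^sup>2)"
      using pos[of x] by (simp add: right_diff_distrib)
    finally have 3: "\<phi> (g x) = x powr (a - 2) * (1 + x\<^sup>2)" .
    have 4: "x * x powr (a - 2) = x powr (a - 1)"
      using x by (simp add: powr_mult_base)
    have "\<bar>g' x\<bar> * \<phi> (g x) = 2 * (x * x powr (a - 2)) * (1 + x\<^sup>2) / (1 + x\<^sup>2)\<^sup>2"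
      unfolding 3 using x by (simp add: g'_def)
    also have "\<dots> = 2 * (x powr (a - 1) / (1 + x\<^sup>2))"
      unfolding 4 using pos[of x] by (simp add: power2_eq_square)
    finally show "\<bar>g' x\<bar> * \<phi> (g x) = 2 * (x powr (a - 1) / (1 + x\<^sup>2))" .
  qed
  from has_integral_mult_right[OF this, of "1/2"]
  have "((\<lambda>x. x powr (a - 1) / (1 + x\<^sup>2)) has_integral (Beta (a/2) (1 - a/2) / 2)) {0<..}"
    by simp
  \<comment> \<open>As \<open>Gamma 1 = 1\<close>, only \<open>Gamma z * Gamma (1 - z)\<close> at
    \<open>z = a / 2\<close> is left. Euler's reflection formula is used over the complex numbers
    and carried back by injectivity of \<open>of_real\<close>.\<close>
  moreover have "Beta (a/2) (1 - a/2) = pi / sin (pi * a / 2)"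
  proof -
    have "complex_of_real (Beta (a/2) (1 - a/2)) = of_real (pi / sin (pi * a / 2))"
      using Gamma_reflection_complex[of "of_real (a/2)"]
      by (simp add: Beta_def flip: Gamma_complex_of_real sin_of_real)
    then show ?thesis by (simp only: of_real_eq_iff)
  qed
  ultimately show ?thesis
    by (subst nn_integral_has_integral_lebesgue') (auto simp: mult.commute)
qed

text \<open>An explicit antiderivative tends to 0 at infinity because of its exponential factor, so
  the integral is minus its value at 0.\<close>

lemma nn_integral_1_minus_cos_exp:
  fixes y :: real
  assumes "y > 0"
  shows "(\<integral>\<^sup>+t. ennreal ((1 - cos t) * exp (- t * y)) * indicator {0<..} t \<partial>lborel)
    = ennreal (1 / (y * (1 + y\<^sup>2)))"
proof -
  \<comment> \<open>The part with \<open>1 / y\<close> comes from \<open>exp (- t * y)\<close>; the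
    other part comes from integrating \<open>cos t * exp (- t * y)\<close> by parts twice.\<close>
  define F where "F t = exp (- t * y) * ((y * cos t - sin t) / (1 + y\<^sup>2) - 1 / y)" for t
  have pos: "1 + y\<^sup>2 > 0" by (simp add: add_pos_nonneg)
  have "(F has_real_derivative (1 - cos t) * exp (- t * y)) (at t)" for t
    unfolding F_def using pos assms
    by (auto intro!: derivative_eq_intros simp: divide_simps)
      (simp add: algebra_simps power2_eq_square)
  moreover have "(F \<longlongrightarrow> 0) at_top"
  proof (rule Lim_null_comparison)
    have "\<bar>(y * cos t - sin t) / (1 + y\<^sup>2) - 1 / y\<bar> \<le> y + 1 + 1 / y" for t
    proof -
      have "\<bar>y * cos t - sin t\<bar> \<le> \<bar>y * cos t\<bar> + \<bar>sin t\<bar>" by (rule abs_triangle_ineq4)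
      also have "\<dots> \<le> y + 1"
        using assms by (intro add_mono) (auto simp: abs_mult mult_left_le)
      finally have "\<bar>y * cos t - sin t\<bar> \<le> (y + 1) * (1 + y\<^sup>2)"
        using assms by (rule_tac order_trans) (auto simp: mult_le_cancel_left1)
      then have "\<bar>(y * cos t - sin t) / (1 + y\<^sup>2)\<bar> \<le> y + 1"
        using pos by (simp add: pos_divide_le_eq)
      then show ?thesis using assms by (intro order_trans[OF abs_triangle_ineq4]) auto
    qed
    then show "\<forall>\<^sub>F t in at_top. norm (F t) \<le> exp (- t * y) * (y + 1 + 1 / y)"
      by (intro always_eventually allI) (auto simp: F_def abs_mult)
    have "((\<lambda>t. exp (- t * y)) \<longlongrightarrow> 0) at_top" using assms by real_asymp
    from tendsto_mult_left_zero[OF this]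
    show "((\<lambda>t. exp (- t * y) * (y + 1 + 1 / y)) \<longlongrightarrow> 0) at_top" .
  qed
  ultimately have "(\<integral>\<^sup>+t. ennreal ((1 - cos t) * exp (- t * y)) * indicator {0..} t \<partial>lborel)
      = ennreal (0 - F 0)"
    by (intro nn_integral_FTC_atLeast) auto
  moreover have "0 - F 0 = 1 / (y * (1 + y\<^sup>2))"
    using assms pos by (simp add: F_def field_simps power2_eq_square)
  \<comment> \<open>At \<open>t = 0\<close> the factor \<open>1 - cos t\<close> is zero, so the two
    integrands agree even at the endpoint.\<close>
  moreover have "(\<integral>\<^sup>+t. ennreal ((1 - cos t) * exp (- t * y)) * indicator {0..} t \<partial>lborel)
      = (\<integral>\<^sup>+t. ennreal ((1 - cos t) * exp (- t * y)) * indicator {0<..} t \<partial>lborel)"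
    by (intro nn_integral_cong) (auto simp: indicator_def less_le)
  ultimately show ?thesis by simp
qed

text \<open>The idea is to write \<open>1 / t powr (a + 1)\<close> as a Laplace transform and to exchange the integrals.\<close>
lemma nn_integral_1_minus_cos_div_powr:
  fixes a :: real
  assumes "0 < a" "a < 2"
  shows "(\<integral>\<^sup>+t. ennreal ((1 - cos t) / t powr (a + 1)) * indicator {0<..} t \<partial>lborel)
    = ennreal (pi / (2 * Gamma (a + 1) * sin (pi * a / 2)))" (is "?I = _")
proof -
  have G: "Gamma (a + 1) > 0" using assms by (intro Gamma_real_pos) auto
  have "ennreal (Gamma (a + 1)) * ?I
      = (\<integral>\<^sup>+t. ennreal (1 - cos t) * ennreal (Gamma (a + 1) / t powr (a + 1)) * indicator {0<..} t \<partial>lborel)"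
    using G by (subst nn_integral_cmult[symmetric])
      (auto intro!: nn_integral_cong simp: indicator_def mult_ac simp flip: ennreal_mult')
  also have "\<dots> = (\<integral>\<^sup>+t. \<integral>\<^sup>+y. ennreal (1 - cos t) * indicator {0<..} t *
      (ennreal (y powr (a + 1 - 1) * exp (- t * y)) * indicator {0<..} y) \<partial>lborel \<partial>lborel)"
    using assms
    by (intro nn_integral_cong, subst nn_integral_cmult)
      (use nn_integral_powr_exp[of "a + 1"] in \<open>auto simp: indicator_def\<close>)
  also have "\<dots> = (\<integral>\<^sup>+y. \<integral>\<^sup>+t. ennreal (1 - cos t) * indicator {0<..} t *
      (ennreal (y powr (a + 1 - 1) * exp (- t * y)) * indicator {0<..} y) \<partial>lborel \<partial>lborel)"
    by (rule lborel_pair.Fubini') measurable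
  also have "\<dots> = (\<integral>\<^sup>+y. ennreal (y powr a) * indicator {0<..} y *
      (\<integral>\<^sup>+t. ennreal ((1 - cos t) * exp (- t * y)) * indicator {0<..} t \<partial>lborel) \<partial>lborel)"
    by (intro nn_integral_cong, subst nn_integral_cmult[symmetric])
      (auto intro!: nn_integral_cong simp: ennreal_mult'' mult_ac)
  \<comment> \<open>The inner integral contributes a factor \<open>1 / y\<close>, which lowers the
    exponent from \<open>a\<close> to \<open>a - 1\<close> and leaves the Beta-type
    integrand.\<close>
  also have "\<dots> = (\<integral>\<^sup>+y. ennreal (y powr (a - 1) / (1 + y\<^sup>2)) * indicator {0<..} y \<partial>lborel)"
  proof (intro nn_integral_cong)
    fix y :: real
    have "y powr a * (1 / (y * (1 + y\<^sup>2))) = y powr (a - 1) / (1 + y\<^sup>2)" if "y > 0"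
      using that by (simp add: powr_diff)
    then show "ennreal (y powr a) * indicator {0<..} y *
        (\<integral>\<^sup>+t. ennreal ((1 - cos t) * exp (- t * y)) * indicator {0<..} t \<partial>lborel) =
      ennreal (y powr (a - 1) / (1 + y\<^sup>2)) * indicator {0<..} y"
      by (cases "y > 0") (simp_all only: nn_integral_1_minus_cos_exp ennreal_mult'[symmetric]
          powr_ge_zero indicator_simps greaterThan_iff mult_1_right mult_zero_right mult_zero_left simp_thms)
  qed
  also have "\<dots> = ennreal (pi / (2 * sin (pi * a / 2)))"
    by (rule nn_integral_powr_div_1_plus_square[OF assms])
  finally have "ennreal (1 / Gamma (a + 1)) * (ennreal (Gamma (a + 1)) * ?I)
      = ennreal (1 / Gamma (a + 1)) * ennreal (pi / (2 * sin (pi * a / 2)))" by simp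
  also have "\<dots> = ennreal (pi / (2 * Gamma (a + 1) * sin (pi * a / 2)))"
    using G by (subst ennreal_mult'[symmetric]) (auto simp: mult_ac)
  also have "ennreal (1 / Gamma (a + 1)) * (ennreal (Gamma (a + 1)) * ?I) = ?I"
    using G by (subst mult.assoc[symmetric], subst ennreal_mult'[symmetric]) auto
  finally show ?thesis .
qed

section \<open>Scaling and the sine integral\<close>

text \<open>Substituting \<open>x * t\<close> for \<open>t\<close> multiplies
  \<open>t powr s\<close> by \<open>x powr s\<close>, and the Jacobian takes away one factor
  \<open>x\<close>. This homogeneity reduces every integral with a parameter \<open>x\<close> to a
  fixed one.\<close>

lemma has_bochner_integral_scale_powr:
  fixes h :: "real \<Rightarrow> real"
  assumes "has_bochner_integral lborel (\<lambda>t. indicator {0<..} t * (h t / t powr s)) c" "x > 0"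
  shows "has_bochner_integral lborel (\<lambda>t. indicator {0<..} t * (h (x * t) / t powr s))
    (x powr (s - 1) * c)"
proof -
  have "has_bochner_integral lborel
      (\<lambda>t. indicator {0<..} (0 + x * t) * (h (0 + x * t) / (0 + x * t) powr s)) (c /\<^sub>R \<bar>x\<bar>)"
    using assms(2)
    by (intro lborel_has_bochner_integral_real_affine_iff[THEN iffD1, OF _ assms(1)]) auto
  from has_bochner_integral_mult_right[OF this, of "x powr s"]
  have "has_bochner_integral lborel
      (\<lambda>t. x powr s * (indicator {0<..} (x * t) * (h (x * t) / (x * t) powr s))) (x powr s * (c / x))"
    using assms(2) by (simp add: divide_inverse mult.commute)
  moreover have "x powr s * (indicator {0<..} (x * t) * (h (x * t) / (x * t) powr s))
      = indicator {0<..} t * (h (x * t) / t powr s)" for t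
    using assms(2) by (auto simp: indicator_def powr_mult zero_less_mult_iff)
  moreover have "x powr s * (c / x) = x powr (s - 1) * c"
    using assms(2) by (simp add: powr_diff)
  ultimately show ?thesis by simp
qed

lemma has_bochner_integral_Ioi:
  fixes h :: "real \<Rightarrow> real"
  assumes "(\<integral>\<^sup>+t. ennreal (h t) * indicator {0<..} t \<partial>lborel) = ennreal c"
    and "\<And>t. t > 0 \<Longrightarrow> h t \<ge> 0" and "c \<ge> 0" and [measurable]: "h \<in> borel_measurable borel"
  shows "has_bochner_integral lborel (\<lambda>t. indicator {0<..} t * h t) c"
proof (rule has_bochner_integral_nn_integral)
  have "(\<integral>\<^sup>+t. ennreal (indicator {0<..} t * h t) \<partial>lborel)
      = (\<integral>\<^sup>+t. ennreal (h t) * indicator {0<..} t \<partial>lborel)"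
    by (intro nn_integral_cong) (auto simp: indicator_def)
  with assms(1) show "(\<integral>\<^sup>+t. ennreal (indicator {0<..} t * h t) \<partial>lborel) = ennreal c" by simp
qed (use assms in \<open>auto simp: indicator_def\<close>)

lemma sin_half_pi_pos:
  fixes a :: real
  assumes "0 < a" "a < 2"
  shows "sin (pi * a / 2) > 0"
  using assms by (intro sin_gt_zero) (auto simp: field_simps)

text \<open>Cosine is even, so the case \<open>x = 1\<close> is scaled by
  \<open>\<bar>x\<bar>\<close>; \<open>x = 0\<close> is separate because scaling needs a positive
  factor.\<close>

lemma has_bochner_integral_1_minus_cos:
  fixes a x :: real
  assumes "0 < a" "a < 2"
  shows "has_bochner_integral lborel
    (\<lambda>t. indicator {0<..} t * ((1 - cos (x * t)) / t powr (a + 1)))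
    (\<bar>x\<bar> powr a * (pi / (2 * Gamma (a + 1) * sin (pi * a / 2))))"
proof (cases "x = 0")
  case False
  have "Gamma (a + 1) > 0" using assms by (intro Gamma_real_pos) auto
  then have "has_bochner_integral lborel (\<lambda>t. indicator {0<..} t * ((1 - cos t) / t powr (a + 1)))
      (pi / (2 * Gamma (a + 1) * sin (pi * a / 2)))"
    using sin_half_pi_pos[OF assms]
    by (intro has_bochner_integral_Ioi nn_integral_1_minus_cos_div_powr assms) auto
  from has_bochner_integral_scale_powr[OF this, of "\<bar>x\<bar>"]
  have "has_bochner_integral lborel
      (\<lambda>t. indicator {0<..} t * ((1 - cos (\<bar>x\<bar> * t)) / t powr (a + 1)))
      (\<bar>x\<bar> powr a * (pi / (2 * Gamma (a + 1) * sin (pi * a / 2))))"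
    using False by simp
  moreover have "cos (\<bar>x\<bar> * t) = cos (x * t)" for t
    by (simp add: abs_if)
  ultimately show ?thesis by simp
qed (use has_bochner_integral_zero in auto)

text \<open>The sine integrand changes sign, so integrability must be known before its integral can
  be split. It is dominated by two Beta-type integrands with parameters \<open>1 - a\<close> and
  \<open>2 - a\<close>; the first governs small \<open>t\<close>, the second large
  \<open>t\<close>.\<close>

lemma integrable_sin_div_powr:
  fixes a :: real
  assumes "0 < a" "a < 1"
  shows "integrable lborel (\<lambda>t. indicator {0<..} t * (sin t / t powr (a + 1)))"
proof (rule Bochner_Integration.integrable_bound)
  have 1: "integrable lborel (\<lambda>t. indicator {0<..} t * (t powr (b - 1) / (1 + t\<^sup>2)))"
    if b: "0 < b" "b < 2" for b :: real
  proof -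
    have "has_bochner_integral lborel (\<lambda>t. indicator {0<..} t * (t powr (b - 1) / (1 + t\<^sup>2)))
        (pi / (2 * sin (pi * b / 2)))"
      using sin_half_pi_pos[OF b]
      by (intro has_bochner_integral_Ioi nn_integral_powr_div_1_plus_square b) auto
    then show ?thesis by (rule integrable.intros)
  qed
  show "integrable lborel (\<lambda>t. indicator {0<..} t * (t powr (1 - a - 1) / (1 + t\<^sup>2))
      + indicator {0<..} t * (t powr (2 - a - 1) / (1 + t\<^sup>2)))"
    using assms by (intro Bochner_Integration.integrable_add 1) auto
  show "AE t in lborel. norm (indicator {0<..} t * (sin t / t powr (a + 1)))
      \<le> norm (indicator {0<..} t * (t powr (1 - a - 1) / (1 + t\<^sup>2))
      + indicator {0<..} t * (t powr (2 - a - 1) / (1 + t\<^sup>2)))"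
  proof (intro AE_I2)
    fix t :: real
    show "norm (indicator {0<..} t * (sin t / t powr (a + 1)))
      \<le> norm (indicator {0<..} t * (t powr (1 - a - 1) / (1 + t\<^sup>2))
      + indicator {0<..} t * (t powr (2 - a - 1) / (1 + t\<^sup>2)))"
    proof (cases "t > 0")
      case True
      \<comment> \<open>This adds \<open>\<bar>sin t\<bar> \<le> t\<close> and
        \<open>t\<^sup>2\<close> times \<open>\<bar>sin t\<bar> \<le> 1\<close>.\<close>
      have "\<bar>sin t\<bar> + t\<^sup>2 * \<bar>sin t\<bar> \<le> t + t\<^sup>2 * 1"
        using abs_sin_x_le_abs_x[of t] True by (intro add_mono mult_left_mono) auto
      then have "\<bar>sin t\<bar> \<le> (t + t\<^sup>2) / (1 + t\<^sup>2)"
        by (subst pos_le_divide_eq) (auto simp: algebra_simps add_pos_nonneg)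
      then have "\<bar>sin t\<bar> / t powr (a + 1) \<le> (t + t\<^sup>2) / (1 + t\<^sup>2) / t powr (a + 1)"
        by (rule divide_right_mono) simp
      also have "t powr (a + 1) = t * t powr a" using True by (simp add: powr_add)
      also have "(t + t\<^sup>2) / (1 + t\<^sup>2) / (t * t powr a)
          = t powr (1 - a - 1) / (1 + t\<^sup>2) + t powr (2 - a - 1) / (1 + t\<^sup>2)"
      proof -
        have "t powr (1 - a - 1) = 1 / t powr a" by (simp add: powr_minus_divide)
        moreover have "t powr (2 - a - 1) = t / t powr a"
          using True powr_diff[of t 1 a] by simp
        ultimately show ?thesis
          using True by (simp add: power2_eq_square add_divide_distrib mult_ac)
      qed
      finally show ?thesis using True by (simp add: abs_mult powr_add mult_ac)
    qed simp
  qed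
qed measurable

text \<open>Integration by parts reduces this to the cosine integral with exponent \<open>a + 1\<close>.\<close>
lemma has_bochner_integral_sin_div_powr:
  fixes a :: real
  assumes "0 < a" "a < 1"
  shows "has_bochner_integral lborel (\<lambda>t. indicator {0<..} t * (sin t / t powr (a + 1)))
    (pi / (2 * Gamma (a + 1) * cos (pi * a / 2)))"
proof -
  define F where "F t = (1 - cos t) / t powr (a + 1)" for t :: real
  define f where "f t = sin t / t powr (a + 1) - (a + 1) * ((1 - cos t) / t powr (a + 1 + 1))" for t :: real
  \<comment> \<open>The parameter \<open>a + 1\<close> is still admissible for the cosine integral
    because \<open>a < 1\<close>.\<close>
  have hc: "has_bochner_integral lborel (\<lambda>t. indicator {0<..} t * ((1 - cos t) / t powr (a + 1 + 1)))
      (pi / (2 * Gamma (a + 1 + 1) * sin (pi * (a + 1) / 2)))"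
    using has_bochner_integral_1_minus_cos[of "a + 1" 1] assms by simp
  have int: "integrable lborel (\<lambda>t. indicator {0<..} t * (sin t / t powr (a + 1))
      - (a + 1) * (indicator {0<..} t * ((1 - cos t) / t powr (a + 1 + 1))))"
    using integrable.intros[OF hc]
    by (intro Bochner_Integration.integrable_diff integrable_mult_right integrable_sin_div_powr assms) auto
  have eq: "indicator {0<..} t * (sin t / t powr (a + 1))
      - (a + 1) * (indicator {0<..} t * ((1 - cos t) / t powr (a + 1 + 1)))
      = indicator {0<..} t *\<^sub>R f t" for t
    by (simp add: f_def indicator_def)
  have einterval: "einterval 0 \<infinity> = {0<..}"
    by (auto simp: einterval_def)
  \<comment> \<open>Both boundary values of \<open>F\<close> are 0: near 0, \<open>1 - cos t\<close>
    is of order \<open>t\<^sup>2\<close> while \<open>a + 1 < 2\<close>; at infinity the numerator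
    is bounded.\<close>
  have "(LBINT t=0..\<infinity>. f t) = 0 - 0"
  proof (rule interval_integral_FTC_integrable)
    fix t assume "0 < ereal t" "ereal t < \<infinity>"
    then have t: "t > 0" by simp
    have "((\<lambda>t. 1 - cos t) has_real_derivative sin t) (at t)"
      by (auto intro!: derivative_eq_intros)
    moreover have "((\<lambda>t. t powr (a + 1)) has_real_derivative (a + 1) * t powr a) (at t)"
      using has_real_derivative_powr[OF t, of "a + 1"] by simp
    ultimately have "(F has_real_derivative
        (sin t * t powr (a + 1) - (1 - cos t) * ((a + 1) * t powr a)) / (t powr (a + 1) * t powr (a + 1))) (at t)"
      unfolding F_def using t by (intro DERIV_divide) auto
    also have "(sin t * t powr (a + 1) - (1 - cos t) * ((a + 1) * t powr a)) / (t powr (a + 1) * t powr (a + 1)) = f t"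
      unfolding f_def using t by (simp add: powr_add divide_simps) (simp add: algebra_simps power2_eq_square)
    finally have "(F has_real_derivative f t) (at t)" .
    then show "(F has_vector_derivative f t) (at t)"
      by (simp add: has_real_derivative_iff_has_vector_derivative)
    show "isCont f t" unfolding f_def using t by (auto intro!: continuous_intros)
  next
    show "set_integrable lborel (einterval 0 \<infinity>) f"
      unfolding set_integrable_def einterval using int by (simp only: eq)
    have "(F \<longlongrightarrow> 0) (at_right 0)" unfolding F_def using assms by real_asymp
    then show "((F \<circ> real_of_ereal) \<longlongrightarrow> 0) (at_right 0)"
      by (simp add: ereal_tendsto_simps zero_ereal_def)
    have "(F \<longlongrightarrow> 0) at_top"
    proof (rule Lim_null_comparison)
      show "\<forall>\<^sub>F t in at_top. norm (F t) \<le> 2 / t powr (a + 1)"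
        unfolding F_def by (intro always_eventually allI) (auto intro!: divide_right_mono simp: abs_le_iff)
      show "((\<lambda>t. 2 / t powr (a + 1)) \<longlongrightarrow> 0) at_top" using assms by real_asymp
    qed
    then show "((F \<circ> real_of_ereal) \<longlongrightarrow> 0) (at_left \<infinity>)"
      by (simp add: ereal_tendsto_simps)
  qed simp
  then have "(\<integral>t. indicator {0<..} t * (sin t / t powr (a + 1))
      - (a + 1) * (indicator {0<..} t * ((1 - cos t) / t powr (a + 1 + 1))) \<partial>lborel) = 0"
    unfolding interval_lebesgue_integral_def set_lebesgue_integral_def einterval eq by simp
  with has_bochner_integral_integral_eq[OF has_bochner_integral_diff[OF
      has_bochner_integral_integrable[OF integrable_sin_div_powr[OF assms]]
      has_bochner_integral_mult_right[OF hc, of "a + 1"]]]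
  have "(\<integral>t. indicator {0<..} t * (sin t / t powr (a + 1)) \<partial>lborel)
      = (a + 1) * (pi / (2 * Gamma (a + 1 + 1) * sin (pi * (a + 1) / 2)))"
    by linarith
  \<comment> \<open>The functional equation cancels the factor \<open>a + 1\<close> from the
    integration by parts; the shift by a quarter period then turns sine into cosine.\<close>
  also have "Gamma (a + 1 + 1) = (a + 1) * Gamma (a + 1)"
    using assms by (intro Gamma_plus1) (auto elim!: nonpos_Ints_cases)
  also have "sin (pi * (a + 1) / 2) = cos (pi * a / 2)"
    by (simp add: sin_add distrib_left add_divide_distrib)
  finally show ?thesis
    using assms integrable_sin_div_powr[OF assms] by (simp add: has_bochner_integral_iff)
qed

text \<open>Scaling handles \<open>\<bar>x\<bar>\<close>, and oddness of sine accounts for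
  \<open>sgn x\<close>.\<close>

lemma has_bochner_integral_sin:
  fixes a x :: real
  assumes "0 < a" "a < 1"
  shows "has_bochner_integral lborel
    (\<lambda>t. indicator {0<..} t * (sin (x * t) / t powr (a + 1)))
    (sgn x * \<bar>x\<bar> powr a * (pi / (2 * Gamma (a + 1) * cos (pi * a / 2))))"
proof -
  note h = has_bochner_integral_scale_powr[OF has_bochner_integral_sin_div_powr[OF assms], of "\<bar>x\<bar>"]
  consider "x = 0" | "x > 0" | "x < 0" by linarith
  then show ?thesis
  proof cases
    case 1
    then show ?thesis using has_bochner_integral_zero by auto
  next
    case 2
    then show ?thesis using h by simp
  next
    case 3
    then show ?thesis using has_bochner_integral_minus[OF h] by simp
  qed
qed

section \<open>The real kernel and its integral\<close>

text \<open>This is what remains of the integrand for a point mass at \<open>x\<close> once the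
  phase \<open>iexp (u * x)\<close> is factored out. Apart from the denominator it depends on
  \<open>x\<close> and \<open>t\<close> only through \<open>x * t\<close>.\<close>

definition frac_kernel :: "real \<Rightarrow> real \<Rightarrow> real \<Rightarrow> real" where
  "frac_kernel s x t = 2 * (cos (x * t - pi * s / 2) - cos (pi * s / 2)) / t powr s"

text \<open>The angle \<open>pi * (a + 1) / 2\<close> is \<open>pi * a / 2\<close> advanced by a
  right angle, which exchanges sine and cosine up to sign.\<close>

lemma frac_kernel_eq:
  "frac_kernel (a + 1) x t = 2 * sin (pi * a / 2) * ((1 - cos (x * t)) / t powr (a + 1))
    + 2 * cos (pi * a / 2) * (sin (x * t) / t powr (a + 1))"
proof -
  have "pi * (a + 1) / 2 = pi * a / 2 + pi / 2" by (simp add: field_simps)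
  then have "cos (pi * (a + 1) / 2) = - sin (pi * a / 2)" "sin (pi * (a + 1) / 2) = cos (pi * a / 2)"
    by (simp_all only: cos_add sin_add) simp_all
  then show ?thesis
    unfolding frac_kernel_def cos_diff by (simp add: add_divide_distrib diff_divide_distrib algebra_simps)
qed

text \<open>The coefficients of the splitting cancel the trigonometric denominators of the two
  integrals, so both parts carry the same constant and \<open>1 + sgn x\<close> selects positive
  \<open>x\<close>. For \<open>a = 1\<close> the sine part, which is not integrable near 0 if
  \<open>x\<close> is nonzero, has coefficient zero, and only the even part survives.\<close>

lemma has_bochner_integral_frac_kernel:
  fixes a x :: real
  assumes "0 < a" "a \<le> 1"
  shows "has_bochner_integral lborel (\<lambda>t. indicator {0<..} t * frac_kernel (a + 1) x t)
    (if a = 1 then pi * \<bar>x\<bar> else 2 * pi / Gamma (a + 1) * pos_part_powr x a)"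
proof (cases "a = 1")
  case True
  then show ?thesis
    using has_bochner_integral_mult_right[OF has_bochner_integral_1_minus_cos[of 1 x], of 2]
    by (simp add: frac_kernel_eq[of 1, simplified] Gamma_numeral mult_ac right_diff_distrib)
next
  case False
  with assms have a: "0 < a" "a < 1" "a < 2" by auto
  have c: "cos (pi * a / 2) > 0" using a by (intro cos_gt_zero) (auto simp: field_simps)
  have s: "sin (pi * a / 2) > 0" using a by (intro sin_half_pi_pos) auto
  have G: "Gamma (a + 1) > 0" using a by (intro Gamma_real_pos) auto
  have "has_bochner_integral lborel (\<lambda>t.
      2 * sin (pi * a / 2) * (indicator {0<..} t * ((1 - cos (x * t)) / t powr (a + 1)))
      + 2 * cos (pi * a / 2) * (indicator {0<..} t * (sin (x * t) / t powr (a + 1))))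
    (2 * sin (pi * a / 2) * (\<bar>x\<bar> powr a * (pi / (2 * Gamma (a + 1) * sin (pi * a / 2))))
      + 2 * cos (pi * a / 2) * (sgn x * \<bar>x\<bar> powr a * (pi / (2 * Gamma (a + 1) * cos (pi * a / 2)))))"
    using a
    by (intro has_bochner_integral_add has_bochner_integral_mult_right
        has_bochner_integral_1_minus_cos has_bochner_integral_sin)
  also have "(\<lambda>t. 2 * sin (pi * a / 2) * (indicator {0<..} t * ((1 - cos (x * t)) / t powr (a + 1)))
      + 2 * cos (pi * a / 2) * (indicator {0<..} t * (sin (x * t) / t powr (a + 1))))
    = (\<lambda>t. indicator {0<..} t * frac_kernel (a + 1) x t)"
    by (auto simp: frac_kernel_eq indicator_def fun_eq_iff)
  also have "2 * sin (pi * a / 2) * (\<bar>x\<bar> powr a * (pi / (2 * Gamma (a + 1) * sin (pi * a / 2))))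
      + 2 * cos (pi * a / 2) * (sgn x * \<bar>x\<bar> powr a * (pi / (2 * Gamma (a + 1) * cos (pi * a / 2))))
    = pi / Gamma (a + 1) * ((1 + sgn x) * \<bar>x\<bar> powr a)"
    using c s G by (simp add: field_simps)
  \<comment> \<open>At \<open>x = 0\<close> the factor \<open>1 + sgn x\<close> is 1; the equation
    holds there because \<open>0 powr a = 0\<close>.\<close>
  also have "(1 + sgn x) * \<bar>x\<bar> powr a = 2 * pos_part_powr x a"
    by (auto simp: pos_part_powr_def sgn_if)
  finally show ?thesis using False by (simp add: mult_ac)
qed

text \<open>Homogeneity reduces the integral of the absolute value to its values at 1 and -1, whose
  sum serves as \<open>C\<close>.\<close>

lemma integral_abs_frac_kernel_le:
  fixes a :: real
  assumes "0 < a" "a \<le> 1"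
  obtains C where "C \<ge> 0" "\<And>x. (\<integral>t. \<bar>indicator {0<..} t * frac_kernel (a + 1) x t\<bar> \<partial>lborel) \<le> C * \<bar>x\<bar> powr a"
proof -
  define J where "J x = (\<integral>t. \<bar>indicator {0<..} t * frac_kernel (a + 1) x t\<bar> \<partial>lborel)" for x
  have J_nonneg: "J x \<ge> 0" for x unfolding J_def by simp
  have J_scale: "J (x * s) = x powr a * J s" if "x > 0" for x s
  proof -
    define h where "h y = \<bar>2 * (cos (s * y - pi * (a + 1) / 2) - cos (pi * (a + 1) / 2))\<bar>" for y
    have h: "\<bar>indicator {0<..} t * frac_kernel (a + 1) (x * s) t\<bar>
        = indicator {0<..} t * (h (x * t) / t powr (a + 1))" for x t
      by (simp add: h_def frac_kernel_def indicator_def mult_ac)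
    \<comment> \<open>Writing \<open>1 * s\<close> makes the integrand an instance of the equation
      \<open>h\<close> with \<open>x = 1\<close>.\<close>
    have "integrable lborel (\<lambda>t. \<bar>indicator {0<..} t * frac_kernel (a + 1) (1 * s) t\<bar>)"
      using integrable.intros[OF has_bochner_integral_frac_kernel[OF assms]] by (intro integrable_abs) simp
    then have "has_bochner_integral lborel (\<lambda>t. \<bar>indicator {0<..} t * frac_kernel (a + 1) (1 * s) t\<bar>) (J s)"
      by (simp add: has_bochner_integral_iff J_def)
    then have "has_bochner_integral lborel (\<lambda>t. indicator {0<..} t * (h t / t powr (a + 1))) (J s)"
      by (subst (asm) h) simp
    from has_bochner_integral_scale_powr[OF this that]
    show ?thesis
      unfolding J_def h by (simp add: has_bochner_integral_iff)
  qed
  show ?thesis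
  proof
    show "J 1 + J (- 1) \<ge> 0" using J_nonneg by (intro add_nonneg_nonneg)
    fix x :: real
    consider "x = 0" | "x > 0" | "x < 0" by linarith
    then have "J x \<le> (J 1 + J (- 1)) * \<bar>x\<bar> powr a"
    proof cases
      case 1
      then show ?thesis by (simp add: J_def frac_kernel_def)
    next
      case 2
      with J_scale[of x 1] show ?thesis
        using J_nonneg[of "- 1"] by (simp add: algebra_simps)
    next
      case 3
      with J_scale[of "- x" "- 1"] show ?thesis
        using J_nonneg[of 1] by (simp add: algebra_simps)
    qed
    then show "(\<integral>t. \<bar>indicator {0<..} t * frac_kernel (a + 1) x t\<bar> \<partial>lborel) \<le> (J 1 + J (- 1)) * \<bar>x\<bar> powr a"
      by (simp add: J_def)
  qed
qed

section \<open>Moments and derivatives of the characteristic function\<close>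

text \<open>Values up to 1 have powers at most 1, and for larger ones
  \<open>x ^ k \<le> x powr p\<close>; the constant 1 is integrable because the measure is
  finite.\<close>

lemma (in finite_measure) integrable_power_le_powr:
  fixes X :: "'a \<Rightarrow> real"
  assumes [measurable]: "X \<in> borel_measurable M"
    and p: "integrable M (\<lambda>\<omega>. \<bar>X \<omega>\<bar> powr p)" and k: "real k \<le> p"
  shows "integrable M (\<lambda>\<omega>. \<bar>X \<omega>\<bar> ^ k)"
proof (rule Bochner_Integration.integrable_bound)
  show "integrable M (\<lambda>\<omega>. 1 + \<bar>X \<omega>\<bar> powr p)" using p by simp
  have "x ^ k \<le> 1 + x powr p" if "x \<ge> 0" for x :: real
  proof (cases "x \<le> 1")
    case True
    then have "x ^ k \<le> 1" using that by (intro power_le_one)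
    then show ?thesis by (rule order_trans) simp
  next
    case False
    then have "x ^ k = x powr real k" by (simp add: powr_realpow)
    also have "\<dots> \<le> x powr p" using False k by (intro powr_mono) auto
    finally show ?thesis by simp
  qed
  then show "AE \<omega> in M. norm (\<bar>X \<omega>\<bar> ^ k) \<le> norm (1 + \<bar>X \<omega>\<bar> powr p)"
    by (intro AE_I2) simp
qed measurable

text \<open>This is differentiation under the integral by dominated convergence. The error of the
  difference quotient is controlled by the first-order Taylor remainder of the exponential, weighted
  by \<open>\<bar>X \<omega>\<bar> ^ k\<close>.\<close>

lemma has_vector_derivative_integral_iexp:
  fixes X :: "'a \<Rightarrow> real"
  assumes [measurable]: "X \<in> borel_measurable M"
    and int: "integrable M (\<lambda>\<omega>. \<bar>X \<omega>\<bar> ^ k)" "integrable M (\<lambda>\<omega>. \<bar>X \<omega>\<bar> ^ Suc k)"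
  shows "((\<lambda>t. \<integral>\<omega>. (\<i> * of_real (X \<omega>)) ^ k * iexp (t * X \<omega>) \<partial>M)
    has_vector_derivative (\<integral>\<omega>. (\<i> * of_real (X \<omega>)) ^ Suc k * iexp (t * X \<omega>) \<partial>M)) (at t)"
proof -
  define \<phi> where "\<phi> j s \<omega> = (\<i> * of_real (X \<omega>)) ^ j * iexp (s * X \<omega>)" for j s \<omega>
  have [measurable]: "\<phi> j s \<in> borel_measurable M" for j s unfolding \<phi>_def by measurable
  have norm_\<phi>: "norm (\<phi> j s \<omega>) = \<bar>X \<omega>\<bar> ^ j" for j s \<omega>
    by (simp add: \<phi>_def norm_mult norm_power)
  have int\<phi>: "integrable M (\<phi> j s)" if "integrable M (\<lambda>\<omega>. \<bar>X \<omega>\<bar> ^ j)" for j s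
    by (rule Bochner_Integration.integrable_bound[OF that]) (auto simp: norm_\<phi>)
  define r where "r h \<omega> = \<bar>X \<omega>\<bar> ^ k * (norm (iexp (h * X \<omega>) - (1 + \<i> * of_real (h * X \<omega>))) / \<bar>h\<bar>)"
    for h \<omega>
  \<comment> \<open>The first bound is integrable and uniform in \<open>h\<close>, hence dominates.
    The second tends to 0 with \<open>h\<close> and is used only pointwise, as no moment of order
    \<open>k + 2\<close> is assumed.\<close>
  have r_bound: "r h \<omega> \<le> 2 * \<bar>X \<omega>\<bar> ^ Suc k" "r h \<omega> \<le> \<bar>X \<omega>\<bar> ^ k * (X \<omega>)\<^sup>2 * \<bar>h\<bar> / 2" if "h \<noteq> 0" for h \<omega>
  proof -
    have s: "(\<Sum>j\<le>1. (\<i> * z) ^ j / fact j) = 1 + \<i> * z" for z :: complex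
      by simp
    have "norm (iexp (h * X \<omega>) - (1 + \<i> * of_real (h * X \<omega>))) \<le> 2 * \<bar>h * X \<omega>\<bar>"
      using iexp_approx2[of "h * X \<omega>" 1] by (simp add: s)
    then have "norm (iexp (h * X \<omega>) - (1 + \<i> * of_real (h * X \<omega>))) / \<bar>h\<bar> \<le> 2 * \<bar>X \<omega>\<bar>"
      using that by (simp add: pos_divide_le_eq abs_mult mult_ac)
    from mult_left_mono[OF this, of "\<bar>X \<omega>\<bar> ^ k"]
    show "r h \<omega> \<le> 2 * \<bar>X \<omega>\<bar> ^ Suc k" by (simp add: r_def mult_ac)
    have "norm (iexp (h * X \<omega>) - (1 + \<i> * of_real (h * X \<omega>))) \<le> \<bar>h * X \<omega>\<bar> ^ 2 / 2"
      using iexp_approx1[of "h * X \<omega>" 1] unfolding s by (simp add: numeral_2_eq_2)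
    then have "norm (iexp (h * X \<omega>) - (1 + \<i> * of_real (h * X \<omega>))) / \<bar>h\<bar> \<le> \<bar>X \<omega>\<bar> ^ 2 * \<bar>h\<bar> / 2"
      using that by (simp add: pos_divide_le_eq abs_mult power2_eq_square mult_ac)
    from mult_left_mono[OF this, of "\<bar>X \<omega>\<bar> ^ k"]
    show "r h \<omega> \<le> \<bar>X \<omega>\<bar> ^ k * (X \<omega>)\<^sup>2 * \<bar>h\<bar> / 2"
      by (simp add: r_def mult_ac)
  qed
  have r_nonneg: "r h \<omega> \<ge> 0" for h \<omega> by (simp add: r_def)
  have r_meas[measurable]: "r h \<in> borel_measurable M" for h unfolding r_def by measurable
  have r_int: "integrable M (r h)" if "h \<noteq> 0" for h
    by (rule Bochner_Integration.integrable_bound[of _ "\<lambda>\<omega>. 2 * \<bar>X \<omega>\<bar> ^ Suc k"])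
      (use int r_bound(1)[OF that] r_nonneg in \<open>auto simp del: power_Suc\<close>)
  have quot: "norm (integral\<^sup>L M (\<phi> k (t + h)) - integral\<^sup>L M (\<phi> k t)
      - h *\<^sub>R integral\<^sup>L M (\<phi> (Suc k) t)) / norm h \<le> integral\<^sup>L M (r h)" if "h \<noteq> 0" for h
  proof -
    have "integral\<^sup>L M (\<phi> k (t + h)) - integral\<^sup>L M (\<phi> k t) - h *\<^sub>R integral\<^sup>L M (\<phi> (Suc k) t)
      = (\<integral>\<omega>. \<phi> k (t + h) \<omega> - \<phi> k t \<omega> - h *\<^sub>R \<phi> (Suc k) t \<omega> \<partial>M)"
      using int\<phi>[OF int(1)] int\<phi>[OF int(2)] by simp
    also have "norm \<dots> \<le> (\<integral>\<omega>. norm (\<phi> k (t + h) \<omega> - \<phi> k t \<omega> - h *\<^sub>R \<phi> (Suc k) t \<omega>) \<partial>M)"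
      by (rule integral_norm_bound)
    also have "\<dots> = (\<integral>\<omega>. \<bar>h\<bar> * r h \<omega> \<partial>M)"
    proof (rule Bochner_Integration.integral_cong[OF refl])
      fix \<omega>
      have "\<phi> k (t + h) \<omega> - \<phi> k t \<omega> - h *\<^sub>R \<phi> (Suc k) t \<omega>
        = \<phi> k t \<omega> * (iexp (h * X \<omega>) - (1 + \<i> * of_real (h * X \<omega>)))"
        by (simp add: \<phi>_def algebra_simps exp_add scaleR_conv_of_real)
      then show "norm (\<phi> k (t + h) \<omega> - \<phi> k t \<omega> - h *\<^sub>R \<phi> (Suc k) t \<omega>) = \<bar>h\<bar> * r h \<omega>"
        using that by (simp add: norm_mult norm_\<phi> r_def del: of_real_mult)
    qed
    finally show ?thesis using that by (simp add: pos_divide_le_eq mult.commute)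
  qed
  have "((\<lambda>h. norm (integral\<^sup>L M (\<phi> k (t + h)) - integral\<^sup>L M (\<phi> k t)
      - h *\<^sub>R integral\<^sup>L M (\<phi> (Suc k) t)) / norm h) \<longlongrightarrow> 0) (at 0)"
  proof (rule Lim_null_comparison)
    show "\<forall>\<^sub>F h in at 0. norm (norm (integral\<^sup>L M (\<phi> k (t + h)) - integral\<^sup>L M (\<phi> k t)
      - h *\<^sub>R integral\<^sup>L M (\<phi> (Suc k) t)) / norm h) \<le> integral\<^sup>L M (r h)"
      using quot by (auto simp: eventually_at_filter)
    show "((\<lambda>h. integral\<^sup>L M (r h)) \<longlongrightarrow> 0) (at 0)"
      \<comment> \<open>Dominated convergence applies to sequences, so the limit is tested along
        every null sequence that avoids 0.\<close>
      unfolding tendsto_at_iff_sequentially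
    proof (intro allI impI)
      fix H :: "nat \<Rightarrow> real" assume H: "\<forall>n. H n \<in> UNIV - {0}" "H \<longlonglongrightarrow> 0"
      have "(\<lambda>n. integral\<^sup>L M (r (H n))) \<longlonglongrightarrow> integral\<^sup>L M (\<lambda>_. 0)"
      proof (rule integral_dominated_convergence)
        show "integrable M (\<lambda>\<omega>. 2 * \<bar>X \<omega>\<bar> ^ Suc k)" using int(2) by simp
        show "AE \<omega> in M. norm (r (H n) \<omega>) \<le> 2 * \<bar>X \<omega>\<bar> ^ Suc k" for n
          using r_bound(1)[of "H n"] H(1) r_nonneg by (intro AE_I2) auto
        show "AE \<omega> in M. (\<lambda>n. r (H n) \<omega>) \<longlonglongrightarrow> 0"
        proof (rule AE_I2, rule Lim_null_comparison)
          fix \<omega>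
          show "\<forall>\<^sub>F n in sequentially. norm (r (H n) \<omega>) \<le> \<bar>X \<omega>\<bar> ^ k * (X \<omega>)\<^sup>2 * \<bar>H n\<bar> / 2"
            using r_bound(2)[of "H _"] H(1) r_nonneg by (intro always_eventually allI) auto
          have "(\<lambda>n. \<bar>X \<omega>\<bar> ^ k * (X \<omega>)\<^sup>2 * \<bar>H n\<bar> / 2) \<longlonglongrightarrow> \<bar>X \<omega>\<bar> ^ k * (X \<omega>)\<^sup>2 * \<bar>0\<bar> / 2"
            by (intro tendsto_intros H(2)) auto
          then show "(\<lambda>n. \<bar>X \<omega>\<bar> ^ k * (X \<omega>)\<^sup>2 * \<bar>H n\<bar> / 2) \<longlonglongrightarrow> 0" by simp
        qed
      qed auto
      then show "((\<lambda>h. integral\<^sup>L M (r h)) \<circ> H) \<longlonglongrightarrow> 0" by (simp add: comp_def)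
    qed
  qed
  then show ?thesis
    unfolding has_vector_derivative_def has_derivative_at \<phi>_def
    by (auto intro: bounded_linear_scaleR_left)
qed

text \<open>Each differentiation brings down one factor \<open>\<i> * of_real (X \<omega>)\<close>,
  which is justified as long as the moment of the new order exists.\<close>

lemma (in prob_space) nth_derivative_char:
  fixes X :: "'a \<Rightarrow> real"
  assumes [measurable]: "X \<in> borel_measurable M"
    and "integrable M (\<lambda>\<omega>. \<bar>X \<omega>\<bar> powr p)" "real k \<le> p"
  shows "nth_derivative k (char (distr M borel X))
    = (\<lambda>t. \<integral>\<omega>. (\<i> * of_real (X \<omega>)) ^ k * iexp (t * X \<omega>) \<partial>M)"
  using assms(3)
proof (induction k)
  case 0
  show ?case
    by (simp add: nth_derivative_def char_def integral_distr fun_eq_iff)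
next
  case (Suc k)
  then have IH: "nth_derivative k (char (distr M borel X))
    = (\<lambda>t. \<integral>\<omega>. (\<i> * of_real (X \<omega>)) ^ k * iexp (t * X \<omega>) \<partial>M)"
    by simp
  have "nth_derivative (Suc k) (char (distr M borel X)) t
      = vector_derivative (nth_derivative k (char (distr M borel X))) (at t)" for t
    by (simp add: nth_derivative_def)
  also have "\<dots> t = (\<integral>\<omega>. (\<i> * of_real (X \<omega>)) ^ Suc k * iexp (t * X \<omega>) \<partial>M)" for t
    unfolding IH
    by (intro vector_derivative_at has_vector_derivative_integral_iexp assms(1)
        integrable_power_le_powr[OF assms(1,2)]) (use Suc.prems in auto)
  finally show ?case by (intro ext)
qed

lemma (in prob_space) times_differentiable_char:
  fixes X :: "'a \<Rightarrow> real"
  assumes [measurable]: "X \<in> borel_measurable M"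
    and "integrable M (\<lambda>\<omega>. \<bar>X \<omega>\<bar> powr p)" "real n \<le> p"
  shows "times_differentiable n (char (distr M borel X))"
  unfolding times_differentiable_def
proof (intro allI impI)
  fix k t assume k: "k < n"
  have "((\<lambda>t. \<integral>\<omega>. (\<i> * of_real (X \<omega>)) ^ k * iexp (t * X \<omega>) \<partial>M)
    has_vector_derivative (\<integral>\<omega>. (\<i> * of_real (X \<omega>)) ^ Suc k * iexp (t * X \<omega>) \<partial>M)) (at t)"
    by (intro has_vector_derivative_integral_iexp assms(1)
        integrable_power_le_powr[OF assms(1,2)]) (use k assms(3) in auto)
  then show "nth_derivative k (char (distr M borel X)) differentiable (at t)"
    using k assms(3)
    by (subst nth_derivative_char[OF assms(1,2)]) (auto intro: differentiableI_vector)
qed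

section \<open>Complex powers and the exchange of integrals\<close>

text \<open>For \<open>t > 0\<close> the principal arguments of the two bases are
  \<open>pi / 2\<close> and \<open>- pi / 2\<close>.\<close>

lemma ii_powr_eq:
  fixes s t :: real
  assumes "t > 0"
  shows "(\<i> * of_real t) powr (of_real s) = of_real (t powr s) * cis (pi * s / 2)"
    and "(- \<i> * of_real t) powr (of_real s) = of_real (t powr s) * cis (- (pi * s / 2))"
proof -
  have Ln: "Ln (\<i> * of_real t) = of_real (ln t) + \<i> * of_real pi / 2"
    using assms Ln_times_of_real[of t "\<i>"] by (simp add: mult.commute Ln_of_real)
  have "(\<i> * of_real t) powr (of_real s) = exp (of_real s * Ln (\<i> * of_real t))"
    using assms by (simp add: powr_def)
  also have "\<dots> = of_real (t powr s) * cis (pi * s / 2)"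
    unfolding Ln using assms
    by (simp add: powr_def cis_conv_exp exp_of_real[symmetric] exp_add[symmetric] algebra_simps)
  finally show "(\<i> * of_real t) powr (of_real s) = of_real (t powr s) * cis (pi * s / 2)" .
  have Ln: "Ln (- \<i> * of_real t) = of_real (ln t) - \<i> * of_real pi / 2"
    using assms Ln_times_of_real[of t "- \<i>"] by (simp add: mult.commute Ln_of_real)
  have "(- \<i> * of_real t) powr (of_real s) = exp (of_real s * Ln (- \<i> * of_real t))"
    using assms by (simp add: powr_def)
  also have "\<dots> = of_real (t powr s) * cis (- (pi * s / 2))"
    unfolding Ln using assms
    by (simp add: powr_def cis_conv_exp exp_of_real[symmetric] exp_add[symmetric] algebra_simps)
  finally show "(- \<i> * of_real t) powr (of_real s) = of_real (t powr s) * cis (- (pi * s / 2))" .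
qed

text \<open>After \<open>iexp (u * x)\<close> is factored out, the two quotients are complex
  conjugates, so their sum is twice a real part.\<close>

lemma iexp_quotients_eq_frac_kernel:
  fixes s t u x :: real
  assumes "t > 0"
  shows "(iexp ((u + t) * x) - iexp (u * x)) / (\<i> * of_real t) powr (of_real s)
      + (iexp ((u - t) * x) - iexp (u * x)) / (- \<i> * of_real t) powr (of_real s)
    = iexp (u * x) * of_real (frac_kernel s x t)"
proof -
  define c where "c = pi * s / 2"
  have eq: "(cis (t * x) - 1) * cis (- c) + (cis (- (t * x)) - 1) * cis c
      = of_real (2 * (cos (x * t - c) - cos c))"
    by (simp add: complex_eq_iff cos_diff mult.commute) (simp add: algebra_simps)
  have inv: "z / (of_real (t powr s) * cis d) = z * cis (- d) / of_real (t powr s)" for z d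
    by (simp add: divide_inverse mult_ac flip: cis_inverse)
  have split: "iexp ((u + t) * x) - iexp (u * x) = iexp (u * x) * (cis (t * x) - 1)"
    "iexp ((u - t) * x) - iexp (u * x) = iexp (u * x) * (cis (- (t * x)) - 1)"
    by (simp_all add: cis_conv_exp exp_add[symmetric] algebra_simps)
  have "(iexp ((u + t) * x) - iexp (u * x)) / (\<i> * of_real t) powr (of_real s)
      + (iexp ((u - t) * x) - iexp (u * x)) / (- \<i> * of_real t) powr (of_real s)
    = iexp (u * x) * (((cis (t * x) - 1) * cis (- c) + (cis (- (t * x)) - 1) * cis c) / of_real (t powr s))"
    unfolding split ii_powr_eq[OF assms] inv c_def[symmetric] minus_minus
    by (simp only: add_divide_distrib distrib_left mult.assoc times_divide_eq_right)
  also have "\<dots> = iexp (u * x) * of_real (frac_kernel s x t)"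
    unfolding eq unfolding frac_kernel_def c_def by simp
  finally show ?thesis .
qed

lemma frac_kernel_measurable[measurable]:
  "(\<lambda>(x, t). frac_kernel s x t) \<in> borel_measurable (borel \<Otimes>\<^sub>M borel)"
  unfolding frac_kernel_def by measurable

text \<open>Since \<open>g\<close> is an expectation, the integrand is the expectation of a multiple
  of the kernel, and Fubini's theorem lets the kernel be integrated first. Absolute integrability
  holds because the kernel contributes at most \<open>C * \<bar>X \<omega>\<bar> powr a\<close> and
  the derivative contributes \<open>\<bar>X \<omega>\<bar> ^ l\<close>.\<close>

lemma (in prob_space) frac_integrand_char:
  fixes X :: "'a \<Rightarrow> real" and a u :: real and l :: nat
  assumes [measurable]: "X \<in> borel_measurable M" and a: "0 < a" "a \<le> 1"
    and p: "integrable M (\<lambda>\<omega>. \<bar>X \<omega>\<bar> powr (real l + a))"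
  defines "g \<equiv> nth_derivative l (char (distr M borel X))"
  shows "set_integrable lborel {0<..} (frac_integrand g (a + 1) u)"
    and "(LINT t:{0<..}|lborel. frac_integrand g (a + 1) u t)
      = (\<integral>\<omega>. (\<i> * of_real (X \<omega>)) ^ l * iexp (u * X \<omega>) *
          of_real (if a = 1 then pi * \<bar>X \<omega>\<bar> else 2 * pi / Gamma (a + 1) * pos_part_powr (X \<omega>) a) \<partial>M)"
proof -
  interpret pair_sigma_finite M lborel ..
  define Y where "Y v \<omega> = (\<i> * of_real (X \<omega>)) ^ l * iexp (v * X \<omega>)" for v \<omega>
  have [measurable]: "Y v \<in> borel_measurable M" for v unfolding Y_def by measurable
  have norm_Y: "norm (Y v \<omega>) = \<bar>X \<omega>\<bar> ^ l" for v \<omega>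
    by (simp add: Y_def norm_mult norm_power)
  have int_Y: "integrable M (Y v)" for v
    using integrable_power_le_powr[OF assms(1) p, of l] a
    by (rule_tac Bochner_Integration.integrable_bound[of _ "\<lambda>\<omega>. \<bar>X \<omega>\<bar> ^ l"]) (auto simp: norm_Y)
  have g: "g v = integral\<^sup>L M (Y v)" for v
    unfolding g_def using nth_derivative_char[OF assms(1) p, of l] a by (simp add: Y_def[abs_def])
  \<comment> \<open>With the indicator built in, both integrations run over whole measure
    spaces.\<close>
  define K where "K x t = indicator {0<..} t * frac_kernel (a + 1) x t" for x t
  define H where "H \<omega> t = Y u \<omega> * of_real (K (X \<omega>) t)" for \<omega> t
  have K_bochner: "has_bochner_integral lborel (K x)
      (if a = 1 then pi * \<bar>x\<bar> else 2 * pi / Gamma (a + 1) * pos_part_powr x a)" for x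
    unfolding K_def by (rule has_bochner_integral_frac_kernel[OF a])
  obtain C where C: "C \<ge> 0" "\<And>x. (\<integral>t. \<bar>K x t\<bar> \<partial>lborel) \<le> C * \<bar>x\<bar> powr a"
    unfolding K_def using integral_abs_frac_kernel_le[OF a] by blast
  have H_meas[measurable]: "case_prod H \<in> borel_measurable (M \<Otimes>\<^sub>M lborel)"
    unfolding H_def K_def by measurable
  have int_H: "integrable (M \<Otimes>\<^sub>M lborel) (case_prod H)"
  proof (rule Fubini_integrable)
    show "integrable M (\<lambda>\<omega>. \<integral>t. norm (case_prod H (\<omega>, t)) \<partial>lborel)"
    proof (rule Bochner_Integration.integrable_bound)
      show "integrable M (\<lambda>\<omega>. C * \<bar>X \<omega>\<bar> powr (real l + a))" using p by simp
      show "AE \<omega> in M. norm (\<integral>t. norm (case_prod H (\<omega>, t)) \<partial>lborel)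
          \<le> norm (C * \<bar>X \<omega>\<bar> powr (real l + a))"
      proof (rule AE_I2)
        fix \<omega>
        have "(\<integral>t. norm (H \<omega> t) \<partial>lborel) = \<bar>X \<omega>\<bar> ^ l * (\<integral>t. \<bar>K (X \<omega>) t\<bar> \<partial>lborel)"
          by (simp add: H_def norm_mult norm_Y)
        also have "\<dots> \<le> \<bar>X \<omega>\<bar> ^ l * (C * \<bar>X \<omega>\<bar> powr a)"
          by (intro mult_left_mono C) auto
        \<comment> \<open>The case \<open>X \<omega> = 0\<close> is split off because
          \<open>powr_realpow\<close> needs a positive base; both sides are then 0, even for
          \<open>l = 0\<close>, since \<open>0 powr c = 0\<close>.\<close>
        also have "\<dots> = C * \<bar>X \<omega>\<bar> powr (real l + a)"
          using a by (cases "X \<omega> = 0") (auto simp: powr_add powr_realpow)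
        finally show "norm (\<integral>t. norm (case_prod H (\<omega>, t)) \<partial>lborel) \<le> norm (C * \<bar>X \<omega>\<bar> powr (real l + a))"
          using C(1) by simp
      qed
    qed measurable
    show "AE \<omega> in M. integrable lborel (\<lambda>t. case_prod H (\<omega>, t))"
      using integrable.intros[OF K_bochner] by (intro AE_I2) (auto simp: H_def)
  qed measurable
  \<comment> \<open>For \<open>t > 0\<close> this is linearity of the expectation; for other
    \<open>t\<close> the indicator makes both sides zero.\<close>
  have fst: "(\<integral>\<omega>. H \<omega> t \<partial>M) = indicator {0<..} t *\<^sub>R frac_integrand g (a + 1) u t" for t
  proof (cases "t > 0")
    case True
    have "frac_integrand g (a + 1) u t
      = (\<integral>\<omega>. (Y (u + t) \<omega> - Y u \<omega>) / (\<i> * of_real t) powr (of_real (a + 1))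
          + (Y (u - t) \<omega> - Y u \<omega>) / (- \<i> * of_real t) powr (of_real (a + 1)) \<partial>M)"
      unfolding frac_integrand_def g using int_Y
      by (subst Bochner_Integration.integral_add) auto
    also have "\<dots> = (\<integral>\<omega>. H \<omega> t \<partial>M)"
    proof (rule Bochner_Integration.integral_cong[OF refl])
      fix \<omega>
      have "(Y (u + t) \<omega> - Y u \<omega>) / (\<i> * of_real t) powr (of_real (a + 1))
          + (Y (u - t) \<omega> - Y u \<omega>) / (- \<i> * of_real t) powr (of_real (a + 1))
        = (\<i> * of_real (X \<omega>)) ^ l *
          ((iexp ((u + t) * X \<omega>) - iexp (u * X \<omega>)) / (\<i> * of_real t) powr (of_real (a + 1))
          + (iexp ((u - t) * X \<omega>) - iexp (u * X \<omega>)) / (- \<i> * of_real t) powr (of_real (a + 1)))"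
        unfolding Y_def by (simp only: right_diff_distrib distrib_left times_divide_eq_right)
      also have "\<dots> = H \<omega> t"
        unfolding iexp_quotients_eq_frac_kernel[OF True] H_def Y_def K_def using True by simp
      finally show "(Y (u + t) \<omega> - Y u \<omega>) / (\<i> * of_real t) powr (of_real (a + 1))
          + (Y (u - t) \<omega> - Y u \<omega>) / (- \<i> * of_real t) powr (of_real (a + 1)) = H \<omega> t" .
    qed
    finally show ?thesis using True by simp
  qed (simp add: H_def K_def)
  show "set_integrable lborel {0<..} (frac_integrand g (a + 1) u)"
    unfolding set_integrable_def fst[symmetric] by (rule integrable_snd[OF int_H])
  have "(LINT t:{0<..}|lborel. frac_integrand g (a + 1) u t) = (\<integral>t. \<integral>\<omega>. H \<omega> t \<partial>M \<partial>lborel)"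
    unfolding set_lebesgue_integral_def fst ..
  also have "\<dots> = (\<integral>\<omega>. \<integral>t. H \<omega> t \<partial>lborel \<partial>M)"
    by (rule Fubini_integral[OF int_H])
  also have "\<dots> = (\<integral>\<omega>. Y u \<omega> *
      of_real (if a = 1 then pi * \<bar>X \<omega>\<bar> else 2 * pi / Gamma (a + 1) * pos_part_powr (X \<omega>) a) \<partial>M)"
    using has_bochner_integral_integral_eq[OF K_bochner] by (simp add: H_def)
  finally show "(LINT t:{0<..}|lborel. frac_integrand g (a + 1) u t)
      = (\<integral>\<omega>. (\<i> * of_real (X \<omega>)) ^ l * iexp (u * X \<omega>) *
          of_real (if a = 1 then pi * \<bar>X \<omega>\<bar> else 2 * pi / Gamma (a + 1) * pos_part_powr (X \<omega>) a) \<partial>M)"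
    unfolding Y_def .
qed

section \<open>The formula for the moment of the positive part\<close>

text \<open>Derivative and integral are total functions here, so the conclusion also asserts that
  the derivatives exist and that the integrand is integrable. The order
  \<open>nat \<lfloor>p\<rfloor>\<close> equals \<open>p\<close> when \<open>p\<close> is a natural
  number.\<close>

theorem corollary3p2:
  fixes M :: "'a measure" and X :: "'a \<Rightarrow> real" and p u lam :: real
    and l :: nat and f :: "real \<Rightarrow> complex"
  assumes "prob_space M"
    and "X \<in> borel_measurable M"
    and "p > 0"
    and "integrable M (\<lambda>\<omega>. \<bar>X \<omega>\<bar> powr p)"
    and "f = char (distr M borel X)"
    and "l = nat \<lceil>p - 1\<rceil>"
    and "lam = p - real l"
  shows "times_differentiable l f
    \<and> (p \<in> \<nat> \<longrightarrow> times_differentiable (nat \<lfloor>p\<rfloor>) f)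
    \<and> set_integrable lborel {0<..} (frac_integrand (nth_derivative l f) (lam + 1) u)
    \<and> (\<integral>\<omega>. of_real (pos_part_powr (X \<omega>) p) * exp (\<i> * of_real u * of_real (X \<omega>)) \<partial>M)
      = (if p \<in> \<nat> then nth_derivative (nat \<lfloor>p\<rfloor>) f u / (2 * \<i> powr (of_real p)) else 0)
        + of_real (Gamma (lam + 1)) / (2 * of_real pi * \<i> ^ l)
          * (LINT t:{0<..}|lborel. frac_integrand (nth_derivative l f) (lam + 1) u t)"
proof -
  interpret prob_space M by (rule assms(1))
  note X[measurable] = assms(2)
  \<comment> \<open>As \<open>p > 0\<close>, the ceiling of \<open>p - 1\<close> is nonnegative, so
    \<open>nat\<close> does not truncate it.\<close>
  have l: "p - 1 \<le> real l" "real l < p"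
    using assms(3) unfolding assms(6) by linarith+
  then have lam: "0 < lam" "lam \<le> 1" and p_eq: "p = real l + lam"
    using assms(7) by auto
  \<comment> \<open>Since \<open>lam\<close> lies in \<open>(0, 1]\<close> and differs from
    \<open>p\<close> by an integer, \<open>lam = 1\<close> is exactly the integer case, with
    \<open>p = l + 1\<close>.\<close>
  have p_Nats: "p \<in> \<nat> \<longleftrightarrow> lam = 1"
  proof
    assume "p \<in> \<nat>"
    then obtain n where n: "p = real n" by (auto elim: Nats_cases)
    with l have "l + 1 = n" by linarith
    with n p_eq show "lam = 1" by auto
  next
    assume "lam = 1"
    with p_eq have "p = real (Suc l)" by simp
    then show "p \<in> \<nat>" by (metis of_nat_in_Nats)
  qed
  have int: "integrable M (\<lambda>\<omega>. \<bar>X \<omega>\<bar> powr (real l + lam))"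
    using assms(4) p_eq by simp
  note I = frac_integrand_char[OF X lam int, of u, folded assms(5)]
  have p_floor: "nat \<lfloor>p\<rfloor> = Suc l" "p = real (Suc l)" if "lam = 1"
    using that p_eq by auto
  define E where "E \<omega> = iexp (u * X \<omega>)" for \<omega>
  have [measurable]: "E \<in> borel_measurable M" unfolding E_def by measurable
  have "(\<integral>\<omega>. of_real (pos_part_powr (X \<omega>) p) * exp (\<i> * of_real u * of_real (X \<omega>)) \<partial>M)
      = (\<integral>\<omega>. of_real (pos_part_powr (X \<omega>) p) * E \<omega> \<partial>M)"
    by (simp add: E_def mult.assoc)
  also have "\<dots> = (if p \<in> \<nat> then nth_derivative (nat \<lfloor>p\<rfloor>) f u / (2 * \<i> powr (of_real p)) else 0)
        + of_real (Gamma (lam + 1)) / (2 * of_real pi * \<i> ^ l)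
          * (LINT t:{0<..}|lborel. frac_integrand (nth_derivative l f) (lam + 1) u t)"
  proof (cases "lam = 1")
    case False
    with lam have G: "Gamma (lam + 1) > 0" by (intro Gamma_real_pos) auto
    \<comment> \<open>The prefactor is the reciprocal of the constant in the kernel integral, and
      its \<open>\<i> ^ l\<close> cancels the one from the derivative.\<close>
    have "of_real (Gamma (lam + 1)) / (2 * of_real pi * \<i> ^ l)
          * (LINT t:{0<..}|lborel. frac_integrand (nth_derivative l f) (lam + 1) u t)
      = (\<integral>\<omega>. of_real (Gamma (lam + 1)) / (2 * of_real pi * \<i> ^ l) * ((\<i> * of_real (X \<omega>)) ^ l * E \<omega> *
          of_real (2 * pi / Gamma (lam + 1) * pos_part_powr (X \<omega>) lam)) \<partial>M)"
      unfolding I(2) E_def integral_mult_right_zero using False by simp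
    also have "\<dots> = (\<integral>\<omega>. of_real (pos_part_powr (X \<omega>) p) * E \<omega> \<partial>M)"
    proof (rule Bochner_Integration.integral_cong[OF refl])
      fix \<omega>
      have "pos_part_powr (X \<omega>) p = X \<omega> ^ l * pos_part_powr (X \<omega>) lam"
        by (auto simp: pos_part_powr_def p_eq powr_add powr_realpow)
      then show "of_real (Gamma (lam + 1)) / (2 * of_real pi * \<i> ^ l) * ((\<i> * of_real (X \<omega>)) ^ l * E \<omega> *
          of_real (2 * pi / Gamma (lam + 1) * pos_part_powr (X \<omega>) lam))
        = of_real (pos_part_powr (X \<omega>) p) * E \<omega>"
        using G by (simp add: power_mult_distrib field_simps)
    qed
    finally show ?thesis using False p_Nats by simp
  next
    case True
    note p_Suc = p_floor[OF True]
    have "Gamma (lam + 1) = 1" using True Gamma_numeral[of Num.One] by (simp add: Gamma_numeral)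
    have int1: "integrable M (\<lambda>\<omega>. (\<i> * of_real (X \<omega>)) ^ Suc l * E \<omega>)"
      and int2: "integrable M (\<lambda>\<omega>. (\<i> * of_real (X \<omega>)) ^ l * E \<omega> * of_real (pi * \<bar>X \<omega>\<bar>))"
    proof -
      have 1: "integrable M (\<lambda>\<omega>. \<bar>X \<omega>\<bar> ^ Suc l)"
        using integrable_power_le_powr[OF X assms(4), of "Suc l"] p_Suc by simp
      show "integrable M (\<lambda>\<omega>. (\<i> * of_real (X \<omega>)) ^ Suc l * E \<omega>)"
        by (rule Bochner_Integration.integrable_bound[OF 1])
          (auto simp: E_def norm_mult norm_power)
      show "integrable M (\<lambda>\<omega>. (\<i> * of_real (X \<omega>)) ^ l * E \<omega> * of_real (pi * \<bar>X \<omega>\<bar>))"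
        by (rule Bochner_Integration.integrable_bound[of _ "\<lambda>\<omega>. pi * \<bar>X \<omega>\<bar> ^ Suc l"])
          (use 1 in \<open>auto simp: E_def norm_mult norm_power simp del: power_Suc intro!: AE_I2\<close>, simp add: mult_ac)
    qed
    have pw: "\<i> powr of_real p = \<i> ^ Suc l"
      using powr_nat[of \<i> "Suc l"] p_Suc(2) by simp
    have "nth_derivative (nat \<lfloor>p\<rfloor>) f u / (2 * \<i> powr (of_real p))
        + of_real (Gamma (lam + 1)) / (2 * of_real pi * \<i> ^ l)
          * (LINT t:{0<..}|lborel. frac_integrand (nth_derivative l f) (lam + 1) u t)
      = (\<integral>\<omega>. 1 / (2 * \<i> ^ Suc l) * ((\<i> * of_real (X \<omega>)) ^ Suc l * E \<omega>) \<partial>M)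
        + (\<integral>\<omega>. 1 / (2 * of_real pi * \<i> ^ l) * ((\<i> * of_real (X \<omega>)) ^ l * E \<omega> * of_real (pi * \<bar>X \<omega>\<bar>)) \<partial>M)"
      unfolding I(2) pw unfolding integral_mult_right_zero assms(5) p_Suc(1)
      using nth_derivative_char[OF X assms(4), of "Suc l"] p_Suc(2) True \<open>Gamma (lam + 1) = 1\<close>
      by (simp add: E_def)
    also have "\<dots> = (\<integral>\<omega>. 1 / (2 * \<i> ^ Suc l) * ((\<i> * of_real (X \<omega>)) ^ Suc l * E \<omega>)
        + 1 / (2 * of_real pi * \<i> ^ l) * ((\<i> * of_real (X \<omega>)) ^ l * E \<omega> * of_real (pi * \<bar>X \<omega>\<bar>)) \<partial>M)"
      by (intro Bochner_Integration.integral_add[symmetric] integrable_mult_right int1 int2)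
    also have "\<dots> = (\<integral>\<omega>. of_real (pos_part_powr (X \<omega>) p) * E \<omega> \<partial>M)"
    proof (rule Bochner_Integration.integral_cong[OF refl])
      fix \<omega>
      \<comment> \<open>The derivative term supplies half of \<open>X \<omega> ^ Suc l\<close>, the
        integral half of \<open>X \<omega> ^ l * \<bar>X \<omega>\<bar>\<close>; the mean of a
        number and its absolute value is its positive part.\<close>
      have "1 / (2 * \<i> ^ Suc l) * ((\<i> * of_real (X \<omega>)) ^ Suc l * E \<omega>)
          + 1 / (2 * of_real pi * \<i> ^ l) * ((\<i> * of_real (X \<omega>)) ^ l * E \<omega> * of_real (pi * \<bar>X \<omega>\<bar>))
        = of_real (X \<omega> ^ l * ((X \<omega> + \<bar>X \<omega>\<bar>) / 2)) * E \<omega>"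
        by (simp add: power_mult_distrib field_simps)
      also have "X \<omega> ^ l * ((X \<omega> + \<bar>X \<omega>\<bar>) / 2) = pos_part_powr (X \<omega>) p"
        by (auto simp: pos_part_powr_def p_eq True powr_add powr_realpow)
      finally show "1 / (2 * \<i> ^ Suc l) * ((\<i> * of_real (X \<omega>)) ^ Suc l * E \<omega>)
          + 1 / (2 * of_real pi * \<i> ^ l) * ((\<i> * of_real (X \<omega>)) ^ l * E \<omega> * of_real (pi * \<bar>X \<omega>\<bar>))
        = of_real (pos_part_powr (X \<omega>) p) * E \<omega>" .
    qed
    finally show ?thesis using True p_Nats by simp
  qed
  finally show ?thesis
    using I(1) times_differentiable_char[OF X assms(4)] l(2) p_floor p_Nats assms(5) by auto
qed


end
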